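(* Let $n\ge 1$ and $k$ be integers with $\lfloor n/2\rfloor \le k\le \lfloor (2n-2)/3\rfloor$. Then $$|V(\Phi^n_k)|=\binom{n-k-1}{2n-3k-2}$$ and $$|E(\Phi^n_k)|=|E(\Phi^{n-2}_{k-1})|+|E(\Phi^{n-3}_{k-2})|+|V(\Phi^{n-5}_{k-3})|.$$
   Context: A subword of a word is a block of consecutive letters. A binary word (over $\{0,1\}$) of length $n\ge 1$ is Padovan if it starts and ends with $0$, contains no subword $00$, and contains no subword $111$. For $n\ge1$ and $\lfloor n/2\rfloor\le k\le\lfloor(2n-2)/3\rfloor$, the weighted Padovan graph $\Phi^n_k$ is the simple graph whose vertices are all Padovan words of length $n$ with exactly $k$ letters $1$; two vertices are adjacent if one can be obtained from the other by replacing exactly one subword $01$ with $10$. Convention: for all other integer pairs $(n,k)$ (i.e. $n\le 0$, or $k$ outside the indicated range), $\Phi^n_k$ is the empty graph, with no vertices and no edges. *)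

theory Defs
  imports Main "HOL-Library.Sublist"
begin

text \<open>Binary words are lists over the natural numbers \<open>0\<close> and \<open>1\<close>.
  \<^const>\<open>sublist\<close> is the contiguous one (blocks of consecutive letters).\<close>

definition padovan :: "nat list \<Rightarrow> bool" where
  "padovan w \<longleftrightarrow>
     set w \<subseteq> {0, 1} \<and> length w \<ge> 1 \<and> hd w = 0 \<and> last w = 0 \<and>
     \<not> sublist [0, 0] w \<and> \<not> sublist [1, 1, 1] w"

definition swap01 :: "nat list \<Rightarrow> nat list \<Rightarrow> bool" where
  "swap01 u v \<longleftrightarrow> (\<exists>x y. u = x @ [0, 1] @ y \<and> v = x @ [1, 0] @ y)"

definition pad_adj :: "nat list \<Rightarrow> nat list \<Rightarrow> bool" where
  "pad_adj u v \<longleftrightarrow> swap01 u v \<or> swap01 v u"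

text \<open>A simple graph is a pair of a vertex set and a set of edges, each edge being
  the unordered pair of its two endpoints.\<close>

type_synonym 'a sgraph = "'a set \<times> 'a set set"

abbreviation verts :: "'a sgraph \<Rightarrow> 'a set" where "verts \<equiv> fst"

abbreviation edges :: "'a sgraph \<Rightarrow> 'a set set" where "edges \<equiv> snd"

definition padovan_words :: "int \<Rightarrow> int \<Rightarrow> nat list set" where
  "padovan_words n k = {w. padovan w \<and> int (length w) = n \<and> int (count_list w 1) = k}"

text \<open>On integers \<open>div\<close> by a positive number is the floor of the quotient.\<close>

definition weighted_padovan_graph :: "int \<Rightarrow> int \<Rightarrow> nat list sgraph" (\<open>\<Phi>\<close>) where
  "\<Phi> n k =
     (if n \<ge> 1 \<and> n div 2 \<le> k \<and> k \<le> (2 * n - 2) div 3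
      then (padovan_words n k,
            {{u, v} | u v. u \<in> padovan_words n k \<and> v \<in> padovan_words n k \<and> pad_adj u v})
      else ({}, {}))"

lemma finite_padovan_words: "finite (padovan_words n k)"
proof (rule finite_subset)
  show "padovan_words n k \<subseteq> {w. set w \<subseteq> {0, 1} \<and> length w = nat n}"
    by (auto simp: padovan_words_def padovan_def)
qed (rule finite_lists_length_eq, simp)

lemma finite_verts_Phi: "finite (verts (\<Phi> n k))"
  by (simp add: weighted_padovan_graph_def finite_padovan_words)

lemma finite_edges_Phi: "finite (edges (\<Phi> n k))"
proof (rule finite_subset)
  show "edges (\<Phi> n k) \<subseteq> Pow (padovan_words n k)"
    by (auto simp: weighted_padovan_graph_def)
qed (simp add: finite_padovan_words)

lemma card_edge_Phi: "e \<in> edges (\<Phi> n k) \<Longrightarrow> card e = 2"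
  by (auto simp: weighted_padovan_graph_def pad_adj_def swap01_def split: if_splits)

end

theory Submission
  imports Defs
begin

text \<open>A Padovan word is \<open>0\<close> followed by blocks \<open>10\<close> and \<open>110\<close>. A word of length \<open>n\<close> with \<open>k\<close> ones
  has \<open>n - k - 1\<close> blocks, of which \<open>2n - 3k - 2\<close> are short, and any choice of the short blocks is
  possible. An edge exchanges two neighbouring blocks of different kinds. Either both endpoints
  have the same first block, which can be deleted, or the exchange involves the first two blocks,
  and then the common rest of the two words is an arbitrary Padovan word.\<close>

section \<open>Decomposition of Padovan words into blocks\<close>

lemma padovan_hd: "padovan w \<Longrightarrow> hd w = 0 \<and> w \<noteq> []"
  by (auto simp: padovan_def)

text \<open>After the initial 0, the exclusion of 00 and 111 leaves one or two letters 1 before the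
  next 0. The closing 0 of the removed block serves as the initial 0 of \<open>v\<close>.
  Conversely, as \<open>v\<close> starts with 0, prepending 01 or 011 creates neither 00 nor
  111.\<close>

lemma padovan_iff:
  "padovan w \<longleftrightarrow> w = [0] \<or> (\<exists>v. w = 0 # 1 # v \<and> padovan v) \<or> (\<exists>v. w = 0 # 1 # 1 # v \<and> padovan v)"
  (is "_ \<longleftrightarrow> ?R")
proof
  assume w: "padovan w"
  then obtain u where u: "w = 0 # u"
    by (cases w) (auto simp: padovan_def)
  show ?R
  proof (cases u)
    case Nil
    with u show ?thesis by simp
  next
    case (Cons b v)
    with w u have b: "b = 1" "v \<noteq> []"
      by (auto simp: padovan_def sublist_Cons_right)
    then obtain c v' where v: "v = c # v'" by (cases v) auto
    show ?thesis
    proof (cases "c = 0")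
      case True
      with w u Cons b v have "padovan v"
        by (auto simp: padovan_def sublist_Cons_right)
      with u Cons b show ?thesis by simp
    next
      case False
      with w u Cons b v have "c = 1" "v' \<noteq> []"
        by (auto simp: padovan_def)
      with w u Cons b v have "padovan v'"
        by (cases v') (auto simp: padovan_def sublist_Cons_right)
      with u Cons b v \<open>c = 1\<close> show ?thesis by simp
    qed
  qed
next
  have "padovan (0 # 1 # v) \<and> padovan (0 # 1 # 1 # v)" if "padovan v" for v
    using padovan_hd[OF that] that by (cases v) (auto simp: padovan_def sublist_Cons_right)
  moreover assume ?R
  ultimately show "padovan w"
    by (auto simp: padovan_def sublist_Cons_right)
qed

lemma padovan_Cons01: "padovan v \<Longrightarrow> padovan (0 # Suc 0 # v)"
  and padovan_Cons011: "padovan v \<Longrightarrow> padovan (0 # Suc 0 # Suc 0 # v)"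
  by (subst padovan_iff; simp)+

lemma padovan_induct [consumes 1, case_names single short long]:
  assumes "padovan w"
    and "P [0]"
    and "\<And>v. padovan v \<Longrightarrow> P v \<Longrightarrow> P (0 # 1 # v)"
    and "\<And>v. padovan v \<Longrightarrow> P v \<Longrightarrow> P (0 # 1 # 1 # v)"
  shows "P w"
  using assms(1)
proof (induction w rule: length_induct)
  case (1 w)
  then show ?case
    using assms(2-4) padovan_iff[of w] by force
qed

text \<open>A block 10 adds 2 letters and 1 one, a block 110 adds 3 letters and 2 ones. The first
  bound is tight when all blocks are short, the second when all are long.\<close>

lemma padovan_count_bounds:
  assumes "padovan w"
  shows "length w \<le> 2 * count_list w 1 + 1" and "3 * count_list w 1 + 2 \<le> 2 * length w"
  using assms by (induction rule: padovan_induct) auto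

lemma padovan_words_bounds:
  assumes "w \<in> padovan_words n k"
  shows "n \<ge> 1 \<and> n div 2 \<le> k \<and> k \<le> (2 * n - 2) div 3"
proof -
  have w: "padovan w" and n: "n = int (length w)" and k: "k = int (count_list w 1)"
    using assms by (auto simp: padovan_words_def)
  have "length w \<ge> 1" using w unfolding padovan_def by blast
  with padovan_count_bounds[OF w] show ?thesis
    unfolding n k by linarith
qed

text \<open>The convention for \<open>\<Phi>\<close> outside the range thus agrees with the general
  formula, so the recursions below hold for all integers without case distinctions.\<close>

lemma padovan_words_empty:
  "\<not> (n \<ge> 1 \<and> n div 2 \<le> k \<and> k \<le> (2 * n - 2) div 3) \<Longrightarrow> padovan_words n k = {}"
  using padovan_words_bounds by blast

section \<open>Edges as ordered pairs, oriented from 01 to 10\<close>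

definition swap_pairs :: "int \<Rightarrow> int \<Rightarrow> (nat list \<times> nat list) set" where
  "swap_pairs n k = {(u, v). u \<in> padovan_words n k \<and> v \<in> padovan_words n k \<and> swap01 u v}"

lemma verts_Phi: "verts (\<Phi> n k) = padovan_words n k"
  by (auto simp: weighted_padovan_graph_def padovan_words_empty)

lemma edges_Phi: "edges (\<Phi> n k) = (\<lambda>(u, v). {u, v}) ` swap_pairs n k"
proof -
  have "edges (\<Phi> n k) =
      {{u, v} | u v. u \<in> padovan_words n k \<and> v \<in> padovan_words n k \<and> pad_adj u v}"
    by (auto simp: weighted_padovan_graph_def padovan_words_empty)
  also have "\<dots> = (\<lambda>(u, v). {u, v}) ` swap_pairs n k"
    by (fastforce simp: swap_pairs_def pad_adj_def insert_commute)
  finally show ?thesis .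
qed

lemma swap01_Nil: "\<not> swap01 [] v" "\<not> swap01 u []"
  by (auto simp: swap01_def)

lemma swap01_Cons:
  "swap01 (a # u) (b # v) \<longleftrightarrow>
     a = b \<and> swap01 u v \<or> a = 0 \<and> b = 1 \<and> (\<exists>y. u = 1 # y \<and> v = 0 # y)"
  (is "_ \<longleftrightarrow> ?R")
proof
  assume "swap01 (a # u) (b # v)"
  then obtain x y where "a # u = x @ [0, 1] @ y" "b # v = x @ [1, 0] @ y"
    by (auto simp: swap01_def)
  then show ?R
    by (cases x) (auto simp: swap01_def)
next
  assume ?R
  then show "swap01 (a # u) (b # v)"
  proof
    assume "a = b \<and> swap01 u v"
    then obtain x y where "a = b" "u = x @ [0, 1] @ y" "v = x @ [1, 0] @ y"
      by (auto simp: swap01_def)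
    then have "a # u = (a # x) @ [0, 1] @ y" "b # v = (a # x) @ [1, 0] @ y"
      by simp_all
    then show ?thesis unfolding swap01_def by blast
  next
    assume "a = 0 \<and> b = 1 \<and> (\<exists>y. u = 1 # y \<and> v = 0 # y)"
    then obtain y where "a # u = [] @ [0, 1] @ y" "b # v = [] @ [1, 0] @ y"
      by auto
    then show ?thesis unfolding swap01_def by blast
  qed
qed

text \<open>At the first position where the two words differ, the source has 0 and the target has 1;
  this fixes the direction.\<close>

lemma swap01_asym: "swap01 u v \<Longrightarrow> \<not> swap01 v u"
proof (induction u arbitrary: v)
  case (Cons a u)
  then show ?case
    by (cases v) (auto simp: swap01_Cons swap01_Nil)
qed (simp add: swap01_Nil)

text \<open>By asymmetry of \<open>swap01\<close>, each edge comes from only one ordered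
  pair.\<close>

lemma card_edges_Phi: "card (edges (\<Phi> n k)) = card (swap_pairs n k)"
proof -
  have "inj_on (\<lambda>(u, v). {u, v}) (swap_pairs n k)"
    by (auto simp: inj_on_def swap_pairs_def doubleton_eq_iff dest: swap01_asym)
  then show ?thesis
    by (simp add: edges_Phi card_image)
qed

section \<open>Counting the vertices\<close>

lemma padovan_words_rec:
  "padovan_words n k =
     (if n = 1 \<and> k = 0 then {[0]} else {}) \<union>
     (\<lambda>v. 0 # 1 # v) ` padovan_words (n - 2) (k - 1) \<union>
     (\<lambda>v. 0 # 1 # 1 # v) ` padovan_words (n - 3) (k - 2)"
  (is "?L = ?R")
proof (rule set_eqI)
  fix w
  show "w \<in> ?L \<longleftrightarrow> w \<in> ?R"
    using padovan_iff[of w] by (auto simp: padovan_words_def image_iff)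
qed

lemma card_padovan_words_rec:
  "card (padovan_words n k) =
     (if n = 1 \<and> k = 0 then 1 else 0) + card (padovan_words (n - 2) (k - 1))
     + card (padovan_words (n - 3) (k - 2))"
proof -
  let ?S = "if n = 1 \<and> k = 0 then {[0 :: nat]} else {}"
  let ?A = "(\<lambda>v. 0 # 1 # v) ` padovan_words (n - 2) (k - 1)"
  let ?B = "(\<lambda>v. 0 # 1 # 1 # v) ` padovan_words (n - 3) (k - 2)"
  have cards: "card ?A = card (padovan_words (n - 2) (k - 1))"
    "card ?B = card (padovan_words (n - 3) (k - 2))"
    by (simp_all add: card_image inj_on_def)
  have AB: "?A \<inter> ?B = {}"
    by (auto simp: padovan_words_def dest: padovan_hd)
  have "?S \<inter> (?A \<union> ?B) = {}"
    by auto
  then have "card (?S \<union> (?A \<union> ?B)) = card ?S + card (?A \<union> ?B)"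
    by (intro card_Un_disjoint) (simp_all add: finite_padovan_words)
  also have "card (?A \<union> ?B) = card ?A + card ?B"
    by (intro card_Un_disjoint AB finite_imageI finite_padovan_words)
  also have "card ?S + (card ?A + card ?B) = (if n = 1 \<and> k = 0 then 1 else 0)
      + card (padovan_words (n - 2) (k - 1)) + card (padovan_words (n - 3) (k - 2))"
    unfolding cards by simp
  finally show ?thesis
    unfolding padovan_words_rec[of n k] Un_assoc .
qed

text \<open>Words with \<open>m\<close> blocks, \<open>j\<close> of them short, have length \<open>1 + 3 m - j\<close> and \<open>2 m - j\<close> ones.\<close>

lemma card_padovan_words_blocks:
  "card (padovan_words (1 + 3 * int m - j) (2 * int m - j)) = (if j < 0 then 0 else m choose nat j)"
proof (induction m arbitrary: j)
  case 0
  \<comment> \<open>For \<open>m = 0\<close> both smaller sets in the recursion require as many ones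
    as letters, which is impossible for a word starting with 0.\<close>
  have empty: "padovan_words i i = {}" for i
    by (rule padovan_words_empty) linarith
  have "1 - j - 2 = - j - 1" "1 - j - 3 = - j - 2"
    by simp_all
  then have "card (padovan_words (1 - j) (- j)) = (if j = 0 then 1 else 0)"
    using card_padovan_words_rec[of "1 - j" "- j"] by (simp only: empty) simp
  then show ?case
    by (cases "j = 0") (auto simp: binomial_eq_0)
next
  case (Suc m)
  \<comment> \<open>Removing a short first block lowers \<open>j\<close> by one, removing a long one
    keeps \<open>j\<close>; the result is Pascal's rule.\<close>
  have "card (padovan_words (1 + 3 * int (Suc m) - j) (2 * int (Suc m) - j)) =
      card (padovan_words (1 + 3 * int m - (j - 1)) (2 * int m - (j - 1)))
      + card (padovan_words (1 + 3 * int m - j) (2 * int m - j))"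
    by (subst card_padovan_words_rec) (auto simp: algebra_simps)
  also have "\<dots> = (if j < 0 then 0 else Suc m choose nat j)"
    unfolding Suc.IH
  proof (cases "j \<le> 0")
    case False
    then have "nat j = Suc (nat (j - 1))" by simp
    with False show "(if j - 1 < 0 then 0 else m choose nat (j - 1))
        + (if j < 0 then 0 else m choose nat j) = (if j < 0 then 0 else Suc m choose nat j)"
      by simp
  qed auto
  finally show ?case .
qed

section \<open>Recursion for the edges\<close>

lemma swap_pairs_rec:
  "swap_pairs n k =
     (\<lambda>(u, v). (0 # 1 # u, 0 # 1 # v)) ` swap_pairs (n - 2) (k - 1) \<union>
     (\<lambda>(u, v). (0 # 1 # 1 # u, 0 # 1 # 1 # v)) ` swap_pairs (n - 3) (k - 2) \<union>
     (\<lambda>w. (0 # 1 # 0 # 1 # 1 # w, 0 # 1 # 1 # 0 # 1 # w)) ` padovan_words (n - 5) (k - 3)"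
  (is "?L = ?A \<union> ?B \<union> ?C")
proof
  show "?L \<subseteq> ?A \<union> ?B \<union> ?C"
  proof (rule subrelI)
    fix u v assume "(u, v) \<in> ?L"
    then have u: "u \<in> padovan_words n k" and v: "v \<in> padovan_words n k" and s: "swap01 u v"
      by (auto simp: swap_pairs_def)
    have False if "u = [0] \<or> v = [0]"
      using that s by (cases u; cases v) (auto simp: swap01_Cons swap01_Nil)
    \<comment> \<open>The cases are named after the first blocks of \<open>u\<close> and
      \<open>v\<close>, with \<open>s\<close> for short and \<open>l\<close> for long.\<close>
    then consider
        (ss) u' v' where "u = 0 # 1 # u'" "v = 0 # 1 # v'"
          "u' \<in> padovan_words (n - 2) (k - 1)" "v' \<in> padovan_words (n - 2) (k - 1)"
      | (ll) u' v' where "u = 0 # 1 # 1 # u'" "v = 0 # 1 # 1 # v'"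
          "u' \<in> padovan_words (n - 3) (k - 2)" "v' \<in> padovan_words (n - 3) (k - 2)"
      | (sl) u' v' where "u = 0 # 1 # u'" "v = 0 # 1 # 1 # v'"
          "u' \<in> padovan_words (n - 2) (k - 1)" "v' \<in> padovan_words (n - 3) (k - 2)"
      | (ls) u' v' where "u = 0 # 1 # 1 # u'" "v = 0 # 1 # v'"
          "u' \<in> padovan_words (n - 3) (k - 2)" "v' \<in> padovan_words (n - 2) (k - 1)"
      using u v unfolding padovan_words_rec[of n k] by (auto split: if_splits)
    then show "(u, v) \<in> ?A \<union> ?B \<union> ?C"
    proof cases
      case ss
      then have "(u', v') \<in> swap_pairs (n - 2) (k - 1)"
        using s by (simp add: swap_pairs_def swap01_Cons)
      with ss show ?thesis by force
    next
      case ll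
      then have "(u', v') \<in> swap_pairs (n - 3) (k - 2)"
        using s by (simp add: swap_pairs_def swap01_Cons)
      with ll show ?thesis by force
    next
      case sl
      have "padovan u'" "padovan v'"
        using sl by (auto simp: padovan_words_def)
      then have "hd u' = 0" "u' \<noteq> []" "hd v' = 0" "v' \<noteq> []"
        using padovan_hd by auto
      \<comment> \<open>The third letters are 0 in \<open>u\<close> and 1 in \<open>v\<close>, so
        the swap takes place exactly there.\<close>
      then obtain y where y: "u' = 0 # 1 # y" "v' = 0 # y"
        using s sl by (cases u') (auto simp: swap01_Cons)
      \<comment> \<open>As \<open>v'\<close> avoids 00, \<open>y\<close> cannot start with 0; as
        \<open>u'\<close> ends in 0, \<open>y\<close> is not empty. Hence the first block of
        \<open>u'\<close> is long.\<close>
      with \<open>padovan v'\<close> have "y = [] \<or> hd y = 1"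
        by (subst (asm) padovan_iff) auto
      with y \<open>padovan u'\<close> obtain w where w: "y = 1 # w" "padovan w"
        by (subst (asm) padovan_iff) (auto dest: padovan_hd)
      then have "w \<in> padovan_words (n - 5) (k - 3)"
        using sl(3) y by (auto simp: padovan_words_def)
      with sl y w show ?thesis by auto
    next
      case ls
      then have "hd v' = 0" "v' \<noteq> []"
        using padovan_hd by (auto simp: padovan_words_def)
      \<comment> \<open>Here the first difference would be a 1 in \<open>u\<close> against a 0 in
        \<open>v\<close>, the wrong direction for a swap.\<close>
      with ls s have False
        by (cases v') (auto simp: swap01_Cons)
      then show ?thesis ..
    qed
  qed
  show "?A \<union> ?B \<union> ?C \<subseteq> ?L"
    by (auto simp: swap_pairs_def padovan_words_def swap01_Cons
        intro: padovan_Cons01 padovan_Cons011)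
qed

lemma card_swap_pairs_rec:
  "card (swap_pairs n k) =
     card (swap_pairs (n - 2) (k - 1)) + card (swap_pairs (n - 3) (k - 2))
     + card (padovan_words (n - 5) (k - 3))"
proof -
  let ?f = "\<lambda>(u, v). (0 # 1 # u, 0 # 1 # v) :: nat list \<times> nat list"
  let ?g = "\<lambda>(u, v). (0 # 1 # 1 # u, 0 # 1 # 1 # v) :: nat list \<times> nat list"
  let ?h = "\<lambda>w. (0 # 1 # 0 # 1 # 1 # w, 0 # 1 # 1 # 0 # 1 # w) :: nat list \<times> nat list"
  let ?A = "?f ` swap_pairs (n - 2) (k - 1)"
  let ?B = "?g ` swap_pairs (n - 3) (k - 2)"
  let ?C = "?h ` padovan_words (n - 5) (k - 3)"
  have fin: "finite (swap_pairs i j)" for i j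
    by (rule finite_subset[of _ "padovan_words i j \<times> padovan_words i j"])
      (auto simp: swap_pairs_def finite_padovan_words)
  \<comment> \<open>The third letters of the two words tell the sets apart: 0 and 0 in
    \<open>?A\<close>, 1 and 1 in \<open>?B\<close>, 0 and 1 in \<open>?C\<close>.\<close>
  have "?A \<inter> ?B = {}" "?A \<inter> ?C = {}" "?B \<inter> ?C = {}"
    by (auto simp: swap_pairs_def padovan_words_def dest: padovan_hd)
  moreover have "card ?A = card (swap_pairs (n - 2) (k - 1))"
    "card ?B = card (swap_pairs (n - 3) (k - 2))"
    "card ?C = card (padovan_words (n - 5) (k - 3))"
    by (auto intro!: card_image simp: inj_on_def)
  ultimately show ?thesis
    unfolding swap_pairs_rec[of n k]
    by (simp add: card_Un_disjoint fin finite_padovan_words Int_Un_distrib2)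
qed

theorem proposition3p1:
  fixes n k :: int
  assumes "n \<ge> 1" and "n div 2 \<le> k" and "k \<le> (2 * n - 2) div 3"
  shows "card (verts (\<Phi> n k)) = nat (n - k - 1) choose nat (2 * n - 3 * k - 2) \<and>
         card (edges (\<Phi> n k)) =
           card (edges (\<Phi> (n - 2) (k - 1))) + card (edges (\<Phi> (n - 3) (k - 2)))
           + card (verts (\<Phi> (n - 5) (k - 3)))"
proof -
  \<comment> \<open>Both follow from the upper bound on \<open>k\<close> and
    \<open>n \<ge> 1\<close>. With these values as \<open>m\<close> and \<open>j\<close>, the length
    \<open>1 + 3 * m - j\<close> is \<open>n\<close> and the number of ones \<open>2 * m - j\<close>
    is \<open>k\<close>.\<close>
  have "n - k - 1 \<ge> 0" "2 * n - 3 * k - 2 \<ge> 0"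
    using assms by linarith+
  then have "card (padovan_words n k) = nat (n - k - 1) choose nat (2 * n - 3 * k - 2)"
    using card_padovan_words_blocks[of "nat (n - k - 1)" "2 * n - 3 * k - 2"]
    by (simp add: algebra_simps)
  with card_swap_pairs_rec[of n k] show ?thesis
    by (simp add: verts_Phi card_edges_Phi)
qed

end
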